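(* Let $n\ge 2$, let $(x_j)_{j=1}^m$ be a full spark frame of unit vectors for $\mathbb{R}^n$ and let $0<\lambda<1$. Then $(x_j)_{j=1}^m$ does $\lambda$-saturation recovery on $B_{\mathbb{R}^n}$ if and only if $(B^o_\varepsilon([x_j]))_{j=1}^m$ is an $(m-n)$-fold multi packing in $P^{n-1}$ for $\varepsilon=\cos^{-1}(\lambda)$.
   Context: A finite family $(x_j)_{j=1}^m$ in $\mathbb{R}^n$ is a frame of $\mathbb{R}^n$ if there are $A,B>0$ with $A\|x\|^2\le\sum_j|\langle x,x_j\rangle|^2\le B\|x\|^2$ for all $x$ (equivalently, it spans $\mathbb{R}^n$). A frame $(x_j)_{j=1}^m$ of $\mathbb{R}^n$ is full spark if every subfamily of $n$ vectors (with distinct indices) spans $\mathbb{R}^n$. For $\lambda>0$, $\phi_\lambda(t)=t$ if $|t|\le\lambda$ and $\phi_\lambda(t)=\mathrm{sign}(t)\lambda$ if $|t|>\lambda$ ($t\in\mathbb{R}$). The frame does $\lambda$-saturation recovery on $X\subseteq\mathbb{R}^n$ if the map $x\mapsto(\phi_\lambda(\langle x,x_j\rangle))_{j=1}^m$ is one-to-one on $X$. $B_{\mathbb{R}^n}$ is the closed Euclidean unit ball. $P^{n-1}$ is the set of lines through the origin in $\mathbb{R}^n$, with metric $d(L_1,L_2)$ equal to the angle in $[0,\pi/2]$ between the lines; $[x]$ denotes the line spanned by $x\ne 0$, so $d([x],[y])=\cos^{-1}(|\langle x,y\rangle|)$ for unit vectors $x,y$. In a metric space $(X,d)$, $B^o_\varepsilon(x_0)=\{x\in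 X:d(x,x_0)<\varepsilon\}$. For an integer $L\ge 0$, a family of balls $(B^o_\varepsilon(p_j))_{j=1}^m$ is an $L$-fold multi packing in $X$ if for every $x\in X$ one has $d(x,p_j)<\varepsilon$ for at most $L$ values of $j\in\{1,\dots,m\}$. *)

theory Defs
  imports "HOL-Analysis.Analysis"
begin

definition is_frame :: "nat \<Rightarrow> (nat \<Rightarrow> real ^ 'n) \<Rightarrow> bool" where
  "is_frame m x \<longleftrightarrow>
     (\<exists>A>0. \<exists>B>0. \<forall>v. A * (norm v)\<^sup>2 \<le> (\<Sum>j=1..m. \<bar>v \<bullet> x j\<bar>\<^sup>2) \<and>
                    (\<Sum>j=1..m. \<bar>v \<bullet> x j\<bar>\<^sup>2) \<le> B * (norm v)\<^sup>2)"

definition full_spark_frame :: "nat \<Rightarrow> (nat \<Rightarrow> real ^ 'n) \<Rightarrow> bool" where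
  "full_spark_frame m x \<longleftrightarrow>
     is_frame m x \<and> (\<forall>J \<subseteq> {1..m}. card J = CARD('n) \<longrightarrow> span (x ` J) = UNIV)"

definition saturate :: "real \<Rightarrow> real \<Rightarrow> real" where
  "saturate lam t = (if \<bar>t\<bar> \<le> lam then t else sgn t * lam)"

definition saturation_recovery ::
    "real \<Rightarrow> nat \<Rightarrow> (nat \<Rightarrow> real ^ 'n) \<Rightarrow> (real ^ 'n) set \<Rightarrow> bool" where
  "saturation_recovery lam m x X \<longleftrightarrow> inj_on (\<lambda>v. \<lambda>j\<in>{1..m}. saturate lam (v \<bullet> x j)) X"

definition projective_space :: "(real ^ 'n) set set" where
  "projective_space = {L. subspace L \<and> dim L = 1}"

text \<open>The line \<open>[v]\<close>; this is a point of the projective space only for \<open>v \<noteq> 0\<close>.\<close>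

definition line_of :: "real ^ 'n \<Rightarrow> (real ^ 'n) set" where
  "line_of v = span {v}"

text \<open>The angle in \<open>[0, \<pi>/2]\<close> between two lines, given by unit direction vectors with
  suitably chosen signs. The theory of \<open>Metric_space\<close> requires distances to be nonnegative
  also outside the carrier, hence the value \<open>0\<close> there.\<close>

definition line_angle :: "(real ^ 'n) set \<Rightarrow> (real ^ 'n) set \<Rightarrow> real" where
  "line_angle L1 L2 =
     (if L1 \<in> projective_space \<and> L2 \<in> projective_space
      then THE \<theta>. 0 \<le> \<theta> \<and> \<theta> \<le> pi / 2 \<and>
             (\<exists>u\<in>L1. \<exists>v\<in>L2. norm u = 1 \<and> norm v = 1 \<and> u \<bullet> v = cos \<theta>)
      else 0)"

definition multi_packing ::
    "'a set \<Rightarrow> ('a \<Rightarrow> 'a \<Rightarrow> real) \<Rightarrow> nat \<Rightarrow> nat \<Rightarrow> (nat \<Rightarrow> 'a) \<Rightarrow> real \<Rightarrow> bool" where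
  "multi_packing M d L m p \<epsilon> \<longleftrightarrow>
     (\<forall>x\<in>M. card {j \<in> {1..m}. x \<in> Metric_space.mball M d (p j) \<epsilon>} \<le> L)"

lemma line_in_projective_space:
  assumes "v \<noteq> 0"
  shows "line_of v \<in> projective_space"
  using assms by (simp add: line_of_def projective_space_def dim_insert)

lemma projective_space_cases:
  fixes L :: "(real ^ 'n) set"
  assumes "L \<in> projective_space"
  obtains v where "norm v = 1" "L = line_of v"
proof -
  from assms have L: "subspace L" "dim L = 1"
    by (auto simp: projective_space_def)
  then obtain w where w: "w \<in> L" "w \<noteq> 0"
    using dim_eq_0 [of L] by auto
  define v where "v = w /\<^sub>R norm w"
  have v: "norm v = 1" "v \<in> L"
    using w L by (auto simp: v_def subspace_scale)
  have "span {v} = span L"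
  proof (rule dim_eq_span)
    show "{v} \<subseteq> L" using v by simp
    have "v \<noteq> 0" using v by auto
    then show "dim L \<le> dim {v}" using L by (simp add: dim_insert)
  qed
  then have "L = line_of v" using L(1) by (metis line_of_def span_eq_iff)
  with v show ?thesis using that by blast
qed

lemma unit_in_line:
  assumes "norm v = 1" "u \<in> line_of v" "norm u = 1"
  shows "u = v \<or> u = - v"
proof -
  from assms obtain k where k: "u = k *\<^sub>R v"
    by (auto simp: line_of_def span_singleton)
  with assms have "\<bar>k\<bar> = 1" by simp
  then show ?thesis using k by (auto simp: abs_if split: if_splits)
qed

lemma line_angle_line_of:
  fixes u v :: "real ^ 'n"
  assumes u: "norm u = 1" and v: "norm v = 1"
  shows "line_angle (line_of u) (line_of v) = arccos \<bar>u \<bullet> v\<bar>"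
proof -
  have "u \<noteq> 0" "v \<noteq> 0" using u v by auto
  then have "line_of u \<in> projective_space" "line_of v \<in> projective_space"
    by (simp_all add: line_in_projective_space)
  then have "line_angle (line_of u) (line_of v) = (THE \<theta>. 0 \<le> \<theta> \<and> \<theta> \<le> pi / 2 \<and>
      (\<exists>u'\<in>line_of u. \<exists>v'\<in>line_of v. norm u' = 1 \<and> norm v' = 1 \<and> u' \<bullet> v' = cos \<theta>))"
    by (simp add: line_angle_def)
  also have "\<dots> = arccos \<bar>u \<bullet> v\<bar>"
  proof (rule the_equality)
    have le: "\<bar>u \<bullet> v\<bar> \<le> 1" using Cauchy_Schwarz_ineq2 [of u v] u v by simp
    have mem: "u \<in> line_of u" "- u \<in> line_of u" "v \<in> line_of v"
      by (simp_all add: line_of_def span_base span_neg)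
    have "\<exists>u'\<in>line_of u. \<exists>v'\<in>line_of v. norm u' = 1 \<and> norm v' = 1 \<and> u' \<bullet> v' = \<bar>u \<bullet> v\<bar>"
      using mem u v by (cases "u \<bullet> v \<ge> 0") (force intro: bexI [of _ u] bexI [of _ "- u"])+
    then show "0 \<le> arccos \<bar>u \<bullet> v\<bar> \<and> arccos \<bar>u \<bullet> v\<bar> \<le> pi / 2 \<and>
        (\<exists>u'\<in>line_of u. \<exists>v'\<in>line_of v. norm u' = 1 \<and> norm v' = 1 \<and> u' \<bullet> v' = cos (arccos \<bar>u \<bullet> v\<bar>))"
      using le arccos_le_pi2 [of "\<bar>u \<bullet> v\<bar>"] by (auto simp: arccos_lbound cos_arccos_abs)
  next
    fix \<theta>
    assume *: "0 \<le> \<theta> \<and> \<theta> \<le> pi / 2 \<and>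
        (\<exists>u'\<in>line_of u. \<exists>v'\<in>line_of v. norm u' = 1 \<and> norm v' = 1 \<and> u' \<bullet> v' = cos \<theta>)"
    then obtain u' v' where uv: "u' \<in> line_of u" "v' \<in> line_of v" "norm u' = 1" "norm v' = 1"
      "u' \<bullet> v' = cos \<theta>" by blast
    have "\<bar>u' \<bullet> v'\<bar> = \<bar>u \<bullet> v\<bar>"
      using unit_in_line [OF u uv(1,3)] unit_in_line [OF v uv(2,4)] by auto
    moreover have "cos \<theta> \<ge> 0" using * by (intro cos_ge_zero) auto
    ultimately have "cos \<theta> = \<bar>u \<bullet> v\<bar>" using uv by simp
    moreover have "arccos (cos \<theta>) = \<theta>" using * by (intro arccos_cos) auto
    ultimately show "\<theta> = arccos \<bar>u \<bullet> v\<bar>" by simp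
  qed
  finally show ?thesis .
qed

lemma arccos_inner_triangle:
  fixes u v w :: "real ^ 'n"
  assumes u: "norm u = 1" and v: "norm v = 1" and w: "norm w = 1"
  shows "arccos \<bar>u \<bullet> w\<bar> \<le> arccos \<bar>u \<bullet> v\<bar> + arccos \<bar>v \<bullet> w\<bar>"
proof -
  define a b where "a = u \<bullet> v" and "b = v \<bullet> w"
  have uu: "u \<bullet> u = 1" and vv: "v \<bullet> v = 1" and ww: "w \<bullet> w = 1"
    using u v w by (simp_all add: dot_square_norm)
  have a1: "\<bar>a\<bar> \<le> 1" and b1: "\<bar>b\<bar> \<le> 1" and c1: "\<bar>u \<bullet> w\<bar> \<le> 1"
    using Cauchy_Schwarz_ineq2 [of u v] Cauchy_Schwarz_ineq2 [of v w]
      Cauchy_Schwarz_ineq2 [of u w] u v w by (simp_all add: a_def b_def)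
  define p q where "p = u - a *\<^sub>R v" and "q = w - b *\<^sub>R v"
  have pq: "p \<bullet> q = u \<bullet> w - a * b" and pp: "p \<bullet> p = 1 - a\<^sup>2" and qq: "q \<bullet> q = 1 - b\<^sup>2"
    using uu vv ww
    by (auto simp: p_def q_def inner_diff_left inner_diff_right a_def b_def inner_commute
        power2_eq_square algebra_simps)
  have "\<bar>p \<bullet> q\<bar> \<le> norm p * norm q" by (rule Cauchy_Schwarz_ineq2)
  also have "\<dots> = sqrt (1 - a\<^sup>2) * sqrt (1 - b\<^sup>2)" by (simp add: norm_eq_sqrt_inner pp qq)
  finally have "\<bar>u \<bullet> w - a * b\<bar> \<le> sqrt (1 - a\<^sup>2) * sqrt (1 - b\<^sup>2)" by (simp add: pq)
  then have "\<bar>a\<bar> * \<bar>b\<bar> - sqrt (1 - a\<^sup>2) * sqrt (1 - b\<^sup>2) \<le> \<bar>u \<bullet> w\<bar>"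
    unfolding abs_mult [symmetric] by linarith
  moreover have "cos (arccos \<bar>a\<bar> + arccos \<bar>b\<bar>)
      = \<bar>a\<bar> * \<bar>b\<bar> - sqrt (1 - a\<^sup>2) * sqrt (1 - b\<^sup>2)"
    using a1 b1 by (simp add: cos_add cos_arccos_abs sin_arccos_abs)
  ultimately have "cos (arccos \<bar>a\<bar> + arccos \<bar>b\<bar>) \<le> \<bar>u \<bullet> w\<bar>" by simp
  then have "arccos \<bar>u \<bullet> w\<bar> \<le> arccos (cos (arccos \<bar>a\<bar> + arccos \<bar>b\<bar>))"
    using c1 by (intro arccos_le_arccos) auto
  also have "\<dots> = arccos \<bar>a\<bar> + arccos \<bar>b\<bar>"
  proof (rule arccos_cos)
    have "arccos \<bar>a\<bar> \<le> pi / 2" "arccos \<bar>b\<bar> \<le> pi / 2"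
      using a1 b1 arccos_le_pi2 [of "\<bar>a\<bar>"] arccos_le_pi2 [of "\<bar>b\<bar>"] by auto
    then show "arccos \<bar>a\<bar> + arccos \<bar>b\<bar> \<le> pi" by linarith
    show "0 \<le> arccos \<bar>a\<bar> + arccos \<bar>b\<bar>" using a1 b1 by (simp add: arccos_lbound)
  qed
  finally show ?thesis by (simp add: a_def b_def)
qed

lemma Metric_space_projective:
  "Metric_space (projective_space :: (real ^ 'n) set set) line_angle"
proof
  fix L1 L2 :: "(real ^ 'n) set"
  show "0 \<le> line_angle L1 L2"
  proof (cases "L1 \<in> projective_space \<and> L2 \<in> projective_space")
    case True
    then obtain u v where uv: "norm u = 1" "norm v = 1" "L1 = line_of u" "L2 = line_of v"
      by (metis projective_space_cases)
    then show ?thesis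
      using Cauchy_Schwarz_ineq2 [of u v] by (simp add: line_angle_line_of arccos_lbound)
  qed (auto simp: line_angle_def)
  show "line_angle L1 L2 = line_angle L2 L1"
  proof (cases "L1 \<in> projective_space \<and> L2 \<in> projective_space")
    case True
    then obtain u v where uv: "norm u = 1" "norm v = 1" "L1 = line_of u" "L2 = line_of v"
      by (metis projective_space_cases)
    then show ?thesis by (simp add: line_angle_line_of inner_commute)
  qed (auto simp: line_angle_def)
next
  fix L1 L2 :: "(real ^ 'n) set"
  assume "L1 \<in> projective_space" "L2 \<in> projective_space"
  then obtain u v where uv: "norm u = 1" "norm v = 1" "L1 = line_of u" "L2 = line_of v"
    by (metis projective_space_cases)
  show "line_angle L1 L2 = 0 \<longleftrightarrow> L1 = L2"
  proof
    assume "line_angle L1 L2 = 0"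
    then have "cos (arccos \<bar>u \<bullet> v\<bar>) = 1" using uv by (simp add: line_angle_line_of)
    then have "\<bar>u \<bullet> v\<bar> = norm u * norm v"
      using uv Cauchy_Schwarz_ineq2 [of u v] by (simp add: cos_arccos_abs)
    then have "u = v \<or> u = - v"
      unfolding norm_cauchy_schwarz_abs_eq using uv by auto
    moreover have "line_of (- v) = line_of v"
      by (auto simp: line_of_def span_singleton intro: range_eqI [of _ _ "- _"])
    ultimately show "L1 = L2" using uv by auto
  next
    assume "L1 = L2"
    then have "line_angle L1 L2 = arccos \<bar>u \<bullet> u\<bar>"
      using uv(3) line_angle_line_of [OF uv(1) uv(1)] by metis
    then show "line_angle L1 L2 = 0" using uv by (simp add: dot_square_norm)
  qed
next
  fix L1 L2 L3 :: "(real ^ 'n) set"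
  assume L: "L1 \<in> projective_space" "L2 \<in> projective_space" "L3 \<in> projective_space"
  obtain u where u: "norm u = 1" "L1 = line_of u" using L(1) by (rule projective_space_cases)
  obtain v where v: "norm v = 1" "L2 = line_of v" using L(2) by (rule projective_space_cases)
  obtain w where w: "norm w = 1" "L3 = line_of w" using L(3) by (rule projective_space_cases)
  show "line_angle L1 L3 \<le> line_angle L1 L2 + line_angle L2 L3"
    using arccos_inner_triangle [OF u(1) v(1) w(1)] u v w by (simp add: line_angle_line_of)
qed

text \<open>A frame has at least \<open>n\<close> members, so \<open>m - n\<close> as a subtraction on \<open>nat\<close> is not truncated.\<close>

lemma full_spark_frame_card_le:
  fixes x :: "nat \<Rightarrow> real ^ 'n"
  assumes "full_spark_frame m x"
  shows "CARD('n) \<le> m"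
proof -
  obtain A where A: "A > 0" "\<And>v. A * (norm v)\<^sup>2 \<le> (\<Sum>j=1..m. \<bar>v \<bullet> x j\<bar>\<^sup>2)"
    using assms by (auto simp: full_spark_frame_def is_frame_def)
  have "v = 0" if "\<And>w. w \<in> span (x ` {1..m}) \<Longrightarrow> orthogonal v w" for v
  proof -
    have "v \<bullet> x j = 0" if "j \<in> {1..m}" for j
      using \<open>\<And>w. w \<in> span (x ` {1..m}) \<Longrightarrow> orthogonal v w\<close> [of "x j"] that
      by (simp add: orthogonal_def span_base)
    then have "A * (norm v)\<^sup>2 \<le> 0" using A(2) [of v] by simp
    then show "v = 0" using A(1) by (simp add: mult_le_0_iff)
  qed
  then have "span (x ` {1..m}) = UNIV"
    using orthogonal_to_subspace_exists_gen [of "x ` {1..m}" UNIV] by (auto simp: psubset_eq)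
  then have "CARD('n) = dim (x ` {1..m})"
    by (metis dim_UNIV dim_span DIM_cart DIM_real mult.right_neutral)
  also have "\<dots> \<le> card (x ` {1..m})" by (rule dim_le_card') simp
  also have "\<dots> \<le> m" using card_image_le [of "{1..m}" x] by simp
  finally show ?thesis .
qed

end

theory Submission
  imports Defs
begin

text \<open>A unit vector \<open>u\<close> lies in the \<open>j\<close>-th ball iff the \<open>j\<close>-th measurement of \<open>u\<close> is strictly
  saturated, so the packing condition says that every point of the unit ball has at least \<open>n\<close>
  unsaturated measurements. If \<open>v\<close> and \<open>w\<close> have the same saturated measurements, then every
  unsaturated measurement of the midpoint of \<open>v\<close> and \<open>w\<close> agrees on \<open>v\<close> and \<open>w\<close>, so \<open>n\<close> of them
  force \<open>v = w\<close> by full spark. Conversely, if fewer than \<open>n\<close> measurements of a unit vector \<open>u\<close> are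
  unsaturated, shrink \<open>u\<close> slightly into the open ball, keeping the saturated ones strictly
  saturated, and then perturb it slightly orthogonally to the unsaturated frame vectors.\<close>

text \<open>Two distinct reals with the same saturation both lie in
  \<open>[lam, \<infinity>)\<close> or both in \<open>(-\<infinity>, -lam]\<close>. Their mean then
  exceeds \<open>lam\<close> strictly in absolute value, since the two cannot both be the
  endpoint.\<close>

lemma saturate_eq_imp_eq:
  assumes "saturate lam a = saturate lam b" "\<bar>(a + b) / 2\<bar> \<le> lam" "0 < lam"
  shows "a = b"
proof -
  have "\<bar>a + b\<bar> \<le> 2 * lam" using assms(2) by (simp add: abs_divide)
  with assms(1,3) show ?thesis
    by (auto simp: saturate_def sgn_if abs_if split: if_splits)
qed

lemma eventually_saturate_perturb_eq:
  assumes "0 < lam" "lam < \<bar>a\<bar>"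
  shows "eventually (\<lambda>t. saturate lam (a + t * b) = saturate lam a) (at_right 0)"
proof -
  \<comment> \<open>The factor \<open>sgn a\<close> treats both signs at once:
    \<open>lam < (a + t * b) * sgn a\<close> says that \<open>a + t * b\<close> lies beyond the
    threshold on the same side as \<open>a\<close>, where \<open>saturate lam\<close> is
    constant.\<close>
  have "((\<lambda>t. (a + t * b) * sgn a) \<longlongrightarrow> (a + 0 * b) * sgn a) (at_right 0)"
    by (intro tendsto_intros)
  moreover have "lam < (a + 0 * b) * sgn a"
    using assms by (simp add: abs_sgn)
  ultimately have "eventually (\<lambda>t. lam < (a + t * b) * sgn a) (at_right 0)"
    by (rule order_tendstoD(1))
  then show ?thesis
    by (rule eventually_mono) (use assms in \<open>auto simp: saturate_def sgn_if abs_if split: if_splits\<close>)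
qed

lemma mem_mball_line_of_iff:
  fixes u y :: "real ^ 'n"
  assumes "norm u = 1" "norm y = 1" "0 \<le> lam" "lam \<le> 1"
  shows "line_of u \<in> Metric_space.mball projective_space line_angle (line_of y) (arccos lam)
    \<longleftrightarrow> lam < \<bar>u \<bullet> y\<bar>"
proof -
  have "line_of u \<in> projective_space" "line_of y \<in> projective_space"
    using assms by (auto intro!: line_in_projective_space)
  \<comment> \<open>Since \<open>arccos\<close> is strictly decreasing, openness of the ball matches
    strict saturation; equality with \<open>lam\<close> counts as unsaturated.\<close>
  moreover have "arccos \<bar>y \<bullet> u\<bar> < arccos lam \<longleftrightarrow> lam < \<bar>y \<bullet> u\<bar>"
    using assms Cauchy_Schwarz_ineq2 [of y u] by (intro arccos_less_mono) auto
  ultimately show ?thesis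
    using assms
    by (simp add: Metric_space.in_mball [OF Metric_space_projective] line_angle_line_of inner_commute)
qed

lemma multi_packing_projective_iff:
  fixes x :: "nat \<Rightarrow> real ^ 'n"
  assumes "\<forall>j\<in>{1..m}. norm (x j) = 1" "0 \<le> lam" "lam \<le> 1"
  shows "multi_packing projective_space line_angle L m (\<lambda>j. line_of (x j)) (arccos lam) \<longleftrightarrow>
    (\<forall>u. norm u = 1 \<longrightarrow> card {j \<in> {1..m}. lam < \<bar>u \<bullet> x j\<bar>} \<le> L)"
proof -
  have eq: "{j \<in> {1..m}. line_of u \<in> Metric_space.mball projective_space line_angle
      (line_of (x j)) (arccos lam)} = {j \<in> {1..m}. lam < \<bar>u \<bullet> x j\<bar>}" if "norm u = 1" for u
    using that assms by (intro Collect_cong conj_cong refl mem_mball_line_of_iff) auto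
  have "(\<forall>K\<in>projective_space. P K) \<longleftrightarrow> (\<forall>u :: real ^ 'n. norm u = 1 \<longrightarrow> P (line_of u))" for P
    by (metis line_in_projective_space norm_zero projective_space_cases zero_neq_one)
  then show ?thesis
    by (simp add: multi_packing_def eq del: atLeastAtMost_iff One_nat_def)
qed

lemma card_saturated_add_unsaturated:
  "card {j \<in> {1..m}. lam < \<bar>u \<bullet> x j\<bar>} + card {j \<in> {1..m}. \<bar>u \<bullet> x j\<bar> \<le> lam} = m"
proof -
  have "card {1..m} = card ({j \<in> {1..m}. lam < \<bar>u \<bullet> x j\<bar>} \<union> {j \<in> {1..m}. \<bar>u \<bullet> x j\<bar> \<le> lam})"
    by (rule arg_cong [where f = card]) auto
  also have "\<dots> = card {j \<in> {1..m}. lam < \<bar>u \<bullet> x j\<bar>} + card {j \<in> {1..m}. \<bar>u \<bullet> x j\<bar> \<le> lam}"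
    by (rule card_Un_disjoint) auto
  finally show ?thesis by simp
qed

text \<open>The packing condition speaks of unit vectors, but midpoints in the ball need not be
  such. Normalizing \<open>z\<close> decreases no \<open>\<bar>z \<bullet> x j\<bar>\<close>, so no
  saturated index is lost; at \<open>z = 0\<close> nothing is saturated.\<close>

lemma card_saturated_le_on_ball:
  fixes x :: "nat \<Rightarrow> 'a::real_inner"
  assumes sphere: "\<forall>u. norm u = 1 \<longrightarrow> card {j \<in> {1..m}. lam < \<bar>u \<bullet> x j\<bar>} \<le> L"
    and "0 \<le> lam" "norm z \<le> 1"
  shows "card {j \<in> {1..m}. lam < \<bar>z \<bullet> x j\<bar>} \<le> L"
proof (cases "z = 0")
  case True
  then show ?thesis using assms by (simp add: not_less)
next
  case False
  have "\<bar>z \<bullet> x j\<bar> \<le> \<bar>sgn z \<bullet> x j\<bar>" for j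
  proof -
    have "\<bar>z \<bullet> x j\<bar> = norm z * \<bar>sgn z \<bullet> x j\<bar>"
      using False by (simp add: sgn_div_norm abs_mult)
    also have "\<dots> \<le> \<bar>sgn z \<bullet> x j\<bar>"
      using assms(3) by (intro mult_left_le_one_le) auto
    finally show ?thesis .
  qed
  then have "card {j \<in> {1..m}. lam < \<bar>z \<bullet> x j\<bar>} \<le> card {j \<in> {1..m}. lam < \<bar>sgn z \<bullet> x j\<bar>}"
    by (intro card_mono) (auto intro: less_le_trans)
  also have "\<dots> \<le> L"
    using False sphere by (simp add: norm_sgn del: One_nat_def atLeastAtMost_iff)
  finally show ?thesis .
qed

lemma saturation_recovery_if_few_saturated:
  fixes x :: "nat \<Rightarrow> real ^ 'n"
  assumes fs: "full_spark_frame m x" and "0 < lam"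
    and sphere: "\<forall>u. norm u = 1 \<longrightarrow> card {j \<in> {1..m}. lam < \<bar>u \<bullet> x j\<bar>} \<le> m - CARD('n)"
  shows "saturation_recovery lam m x (cball 0 1)"
  unfolding saturation_recovery_def
proof (rule inj_onI)
  fix v w :: "real ^ 'n"
  assume vw: "v \<in> cball 0 1" "w \<in> cball 0 1"
    and eq: "(\<lambda>j\<in>{1..m}. saturate lam (v \<bullet> x j)) = (\<lambda>j\<in>{1..m}. saturate lam (w \<bullet> x j))"
  define z where "z = (1/2) *\<^sub>R (v + w)"
  define J where "J = {j \<in> {1..m}. \<bar>z \<bullet> x j\<bar> \<le> lam}"
  have "norm z \<le> 1"
    using vw norm_triangle_ineq [of v w] by (simp add: z_def)
  then have "card {j \<in> {1..m}. lam < \<bar>z \<bullet> x j\<bar>} \<le> m - CARD('n)"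
    by (rule card_saturated_le_on_ball [OF sphere less_imp_le [OF \<open>0 < lam\<close>]])
  \<comment> \<open>The bound \<open>CARD('n) \<le> m\<close> makes the subtraction of naturals
    exact.\<close>
  then have "CARD('n) \<le> card J"
    using card_saturated_add_unsaturated [of m lam z x] full_spark_frame_card_le [OF fs]
    by (simp add: J_def)
  then obtain K where K: "K \<subseteq> J" "card K = CARD('n)"
    by (rule obtain_subset_with_card_n)
  then have "K \<subseteq> {1..m}" by (auto simp: J_def)
  then have "span (x ` K) = UNIV"
    using fs K(2) by (simp add: full_spark_frame_def)
  moreover have "orthogonal (v - w) y" if y: "y \<in> x ` K" for y
  proof -
    obtain j where j: "j \<in> {1..m}" "\<bar>z \<bullet> x j\<bar> \<le> lam" "y = x j"
      using y K(1) unfolding J_def by blast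
    have "saturate lam (v \<bullet> x j) = saturate lam (w \<bullet> x j)"
      using fun_cong [OF eq, of j] j(1) by simp
    \<comment> \<open>The unsaturated indices of \<open>v\<close> and of \<open>w\<close> may have
      fewer than \<open>n\<close> in common; those of the single point \<open>z\<close> serve both
      vectors.\<close>
    then have "v \<bullet> x j = w \<bullet> x j"
      by (rule saturate_eq_imp_eq) (use j(2) \<open>0 < lam\<close> in \<open>simp_all add: z_def inner_add_left\<close>)
    then show ?thesis
      by (simp add: j(3) orthogonal_def inner_diff_left)
  qed
  ultimately have "orthogonal (v - w) (v - w)"
    by (metis UNIV_I orthogonal_to_span)
  then show "v = w"
    by (simp add: orthogonal_def)
qed

lemma few_unsaturated_imp_not_saturation_recovery:
  fixes x :: "nat \<Rightarrow> real ^ 'n"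
  assumes "0 < lam" and u: "norm u = 1"
    and few: "card {j \<in> {1..m}. \<bar>u \<bullet> x j\<bar> \<le> lam} < CARD('n)"
  shows "\<not> saturation_recovery lam m x (cball 0 1)"
proof
  assume rec: "saturation_recovery lam m x (cball 0 1)"
  \<comment> \<open>Borderline indices with equality belong to \<open>J\<close>, so outside
    \<open>J\<close> saturation is strict, an open condition that survives small changes.\<close>
  define J where "J = {j \<in> {1..m}. \<bar>u \<bullet> x j\<bar> \<le> lam}"
  have "dim (x ` J) \<le> card (x ` J)"
    by (rule dim_le_card') (simp add: J_def)
  also have "\<dots> \<le> card J"
    by (rule card_image_le) (simp add: J_def)
  finally have "dim (x ` J) < DIM(real ^ 'n)"
    using few by (simp add: J_def)
  then have "span (x ` J) \<noteq> UNIV"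
    by (metis dim_UNIV dim_span less_irrefl)
  then obtain v where "v \<noteq> 0" and v: "\<And>y. y \<in> span (x ` J) \<Longrightarrow> orthogonal v y"
    using orthogonal_to_subspace_exists_gen [of "x ` J" UNIV] by auto
  \<comment> \<open>As \<open>u\<close> lies on the unit sphere, perturbing it could leave the ball;
    shrinking by \<open>r < 1\<close> first makes room.\<close>
  have "eventually (\<lambda>r. \<forall>j\<in>{1..m} - J. lam < r * \<bar>u \<bullet> x j\<bar>) (at_left 1)"
  proof (rule eventually_ball_finite)
    show "\<forall>j\<in>{1..m} - J. eventually (\<lambda>r. lam < r * \<bar>u \<bullet> x j\<bar>) (at_left 1)"
    proof
      fix j assume "j \<in> {1..m} - J"
      then have "lam < 1 * \<bar>u \<bullet> x j\<bar>" by (auto simp: J_def)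
      moreover have "((\<lambda>r. r * \<bar>u \<bullet> x j\<bar>) \<longlongrightarrow> 1 * \<bar>u \<bullet> x j\<bar>) (at_left 1)"
        by (intro tendsto_intros)
      ultimately show "eventually (\<lambda>r. lam < r * \<bar>u \<bullet> x j\<bar>) (at_left 1)"
        by (metis order_tendstoD(1))
    qed
  qed simp
  moreover have "eventually (\<lambda>r::real. r \<in> {0<..<1}) (at_left 1)"
    by (rule eventually_at_left_real) simp
  ultimately have "eventually (\<lambda>r. (\<forall>j\<in>{1..m} - J. lam < r * \<bar>u \<bullet> x j\<bar>) \<and> r \<in> {0<..<1}) (at_left 1)"
    by (rule eventually_conj)
  from eventually_happens' [OF trivial_limit_at_left_real this]
  obtain r where r: "\<forall>j\<in>{1..m} - J. lam < r * \<bar>u \<bullet> x j\<bar>" "0 < r" "r < 1"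
    unfolding greaterThanLessThan_iff by blast
  define w where "w = r *\<^sub>R u"
  have "norm w < 1" using r u by (simp add: w_def)
  \<comment> \<open>For \<open>j\<close> in \<open>J\<close> the inner product itself stays the
    same, as \<open>v\<close> is orthogonal to \<open>x j\<close>; for the other \<open>j\<close> it
    moves, but only within the saturated range.\<close>
  have "eventually (\<lambda>t. \<forall>j\<in>{1..m}. saturate lam ((w + t *\<^sub>R v) \<bullet> x j) = saturate lam (w \<bullet> x j))
      (at_right 0)"
  proof (rule eventually_ball_finite)
    show "\<forall>j\<in>{1..m}. eventually (\<lambda>t. saturate lam ((w + t *\<^sub>R v) \<bullet> x j) = saturate lam (w \<bullet> x j))
        (at_right 0)"
    proof
      fix j assume j: "j \<in> {1..m}"
      show "eventually (\<lambda>t. saturate lam ((w + t *\<^sub>R v) \<bullet> x j) = saturate lam (w \<bullet> x j)) (at_right 0)"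
      proof (cases "j \<in> J")
        case True
        then have "v \<bullet> x j = 0"
          using v [of "x j"] by (simp add: span_base orthogonal_def)
        then show ?thesis by (simp add: inner_add_left)
      next
        case False
        then have "lam < \<bar>w \<bullet> x j\<bar>"
          using r j by (simp add: w_def abs_mult)
        from eventually_saturate_perturb_eq [OF \<open>0 < lam\<close> this, of "v \<bullet> x j"]
        show ?thesis by (simp add: inner_add_left)
      qed
    qed
  qed simp
  moreover have "eventually (\<lambda>t. norm (w + t *\<^sub>R v) < 1) (at_right 0)"
  proof (rule order_tendstoD(2))
    show "((\<lambda>t. norm (w + t *\<^sub>R v)) \<longlongrightarrow> norm (w + 0 *\<^sub>R v)) (at_right 0)"
      by (intro tendsto_intros)
  qed (use \<open>norm w < 1\<close> in simp)
  moreover have "eventually (\<lambda>t::real. 0 < t) (at_right 0)"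
    by (rule eventually_at_right_less)
  ultimately have "eventually (\<lambda>t. (\<forall>j\<in>{1..m}. saturate lam ((w + t *\<^sub>R v) \<bullet> x j) = saturate lam (w \<bullet> x j))
      \<and> norm (w + t *\<^sub>R v) < 1 \<and> 0 < t) (at_right 0)"
    by (intro eventually_conj)
  from eventually_happens' [OF trivial_limit_at_right_real this]
  obtain t where t: "\<forall>j\<in>{1..m}. saturate lam ((w + t *\<^sub>R v) \<bullet> x j) = saturate lam (w \<bullet> x j)"
      "norm (w + t *\<^sub>R v) < 1" "0 < t"
    by blast
  have "w + t *\<^sub>R v = w"
  proof (rule inj_onD [OF rec [unfolded saturation_recovery_def]])
    show "(\<lambda>j\<in>{1..m}. saturate lam ((w + t *\<^sub>R v) \<bullet> x j)) = (\<lambda>j\<in>{1..m}. saturate lam (w \<bullet> x j))"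
      using t(1) by (intro restrict_ext) blast
  qed (use t(2) \<open>norm w < 1\<close> in auto)
  then show False
    using t(3) \<open>v \<noteq> 0\<close> by simp
qed

theorem proposition3p3:
  fixes x :: "nat \<Rightarrow> real ^ 'n" and m :: nat and lam :: real
  assumes "CARD('n) \<ge> 2"
    and "full_spark_frame m x"
    and "\<forall>j\<in>{1..m}. norm (x j) = 1"
    and "0 < lam" and "lam < 1"
  shows "saturation_recovery lam m x (cball 0 1) \<longleftrightarrow>
    multi_packing projective_space line_angle (m - CARD('n)) m (\<lambda>j. line_of (x j)) (arccos lam)"
proof -
  have "multi_packing projective_space line_angle (m - CARD('n)) m (\<lambda>j. line_of (x j)) (arccos lam)
      \<longleftrightarrow> (\<forall>u. norm u = 1 \<longrightarrow> card {j \<in> {1..m}. lam < \<bar>u \<bullet> x j\<bar>} \<le> m - CARD('n))"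
    using assms by (intro multi_packing_projective_iff) auto
  moreover have "card {j \<in> {1..m}. lam < \<bar>u \<bullet> x j\<bar>} \<le> m - CARD('n)"
    if "saturation_recovery lam m x (cball 0 1)" "norm u = 1" for u
  proof -
    have "CARD('n) \<le> card {j \<in> {1..m}. \<bar>u \<bullet> x j\<bar> \<le> lam}"
      using few_unsaturated_imp_not_saturation_recovery [OF \<open>0 < lam\<close> that(2)] that(1)
      by (meson not_less)
    then show ?thesis
      using card_saturated_add_unsaturated [of m lam u x] by linarith
  qed
  ultimately show ?thesis
    using saturation_recovery_if_few_saturated [OF assms(2,4)] by blast
qed

end
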